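(* Let $D$ be a division algebra over a field $k$ and let $E$ be a division subalgebra of $D$. Then $\mathrm{Ld}(E)\le \mathrm{Ld}^*(D)$.
   Context: Division subalgebras are over $k$. Let $A$ be a $k$-algebra that is a domain. A subframe of $A$ is a finite-dimensional $k$-subspace of $A$ containing $1$. For a subframe $V$ of $A$, $\mathrm{VDI}(V)\in[0,\infty]$ is the supremum of all real $d>0$ for which there is a constant $C>0$ with $\dim_k(VW)\ge \dim_k(W)+C\,(\dim_k W)^{(d-1)/d}$ for every subframe $W$ of $A$ (and $\mathrm{VDI}(V)=0$ if there is no such $d$). The lower transcendence degree is $\mathrm{Ld}(A)=\sup_V \mathrm{VDI}(V)$ over all subframes $V$ of $A$. Similarly, $\mathrm{VDI}^*(V)$ is the supremum of all real $d>0$ for which there is a constant $C>0$ with $\max(\dim_k(VW),\dim_k(WV))\ge \dim_k(W)+C\,(\dim_k W)^{(d-1)/d}$ for every subframe $W$ of $A$ (and $0$ if there is no such $d$), and the strong lower transcendence degree is $\mathrm{Ld}^*(A)=\sup_V\mathrm{VDI}^*(V)$ over all subframes $V$ of $A$. Here $VW$ is the $k$-span of the products $vw$. *)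

theory Defs
  imports Complex_Main "HOL-Library.Extended_Nonnegative_Real"
begin

text \<open>The scalar field is the type \<open>'k\<close>; an algebra is a ring type with a scalar multiplication
  \<open>scale\<close>. Everything below is relative to a carrier set \<open>A\<close> (a subalgebra), so that it applies
  both to \<open>UNIV\<close> and to a proper subalgebra.\<close>

locale domain_algebra = vector_space scale
  for scale :: "'k::field \<Rightarrow> 'a::ring_1_no_zero_divisors \<Rightarrow> 'a" (infixr \<open>*s\<close> 75) +
  assumes scale_mult_left: "(c *s x) * y = c *s (x * y)"
    and scale_mult_right: "x * (c *s y) = c *s (x * y)"
begin

definition subframe :: "'a set \<Rightarrow> 'a set \<Rightarrow> bool" where
  "subframe A V \<longleftrightarrow>
     V \<subseteq> A \<and> subspace V \<and> 1 \<in> V \<and> (\<exists>B. finite B \<and> V \<subseteq> span B)"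

definition prod_space :: "'a set \<Rightarrow> 'a set \<Rightarrow> 'a set" where
  "prod_space V W = span {v * w | v w. v \<in> V \<and> w \<in> W}"

text \<open>In \<^typ>\<open>ennreal\<close> the supremum of the empty set is \<open>0\<close>, which is the convention wanted
  for \<open>VDI\<close> and \<open>VDI_star\<close>.\<close>

definition VDI :: "'a set \<Rightarrow> 'a set \<Rightarrow> ennreal" where
  "VDI A V = Sup {ennreal d | d :: real. d > 0 \<and>
     (\<exists>C::real. C > 0 \<and> (\<forall>W. subframe A W \<longrightarrow>
        real (dim (prod_space V W)) \<ge> real (dim W) + C * real (dim W) powr ((d - 1) / d)))}"

definition Ld :: "'a set \<Rightarrow> ennreal" where
  "Ld A = Sup {VDI A V | V. subframe A V}"

definition VDI_star :: "'a set \<Rightarrow> 'a set \<Rightarrow> ennreal" where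
  "VDI_star A V = Sup {ennreal d | d :: real. d > 0 \<and>
     (\<exists>C::real. C > 0 \<and> (\<forall>W. subframe A W \<longrightarrow>
        real (max (dim (prod_space V W)) (dim (prod_space W V)))
          \<ge> real (dim W) + C * real (dim W) powr ((d - 1) / d)))}"

definition Ld_star :: "'a set \<Rightarrow> ennreal" where
  "Ld_star A = Sup {VDI_star A V | V. subframe A V}"

end

locale division_algebra = domain_algebra scale
  for scale :: "'k::field \<Rightarrow> 'a::division_ring \<Rightarrow> 'a"  (infixr \<open>*s\<close> 75)
begin

definition division_subalgebra :: "'a set \<Rightarrow> bool" where
  "division_subalgebra E \<longleftrightarrow>
     subspace E \<and> 1 \<in> E \<and> (\<forall>x\<in>E. \<forall>y\<in>E. x * y \<in> E) \<and> (\<forall>x\<in>E. x \<noteq> 0 \<longrightarrow> inverse x \<in> E)"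

end

end

theory Submission imports Defs begin

text \<open>As a left module over the division ring \<open>E\<close>, the algebra \<open>D\<close> is free, so for a subframe
  \<open>V\<close> of \<open>E\<close> the left multiplication by \<open>V\<close> on \<open>D\<close> is a direct sum of copies of left
  multiplication by \<open>V\<close> on \<open>E\<close>. A finite-dimensional \<open>W \<subseteq> D\<close> lies in finitely many of these copies
  and need not be their direct sum, but it is filtered: if \<open>f\<close> is the coordinate on
  the last copy, then \<open>dim W = dim (W \<inter> ker f) + dim (f W)\<close>, while \<open>V W\<close> has
  \<open>V (W \<inter> ker f)\<close> inside its kernel part and \<open>V (f W)\<close> inside its image, because \<open>f\<close> is left
  \<open>E\<close>-linear (\<open>dim_prod_space_split\<close>). Hence a growth bound \<open>dim (V X) \<ge> \<phi> (dim X)\<close> for all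
  \<open>X \<subseteq> E\<close> spreads, by induction on the number of copies, to all \<open>W \<subseteq> D\<close>, provided
  \<open>\<phi> (m + n) \<le> \<phi> m + \<phi> n\<close> (\<open>growth_extends\<close>). This holds for
  \<open>\<phi> n = n + C n powr ((d - 1) / d)\<close>, as the exponent is below \<open>1\<close>. So
  every \<open>d\<close> that is admissible for \<open>V\<close> in \<open>E\<close>, with constant \<open>C\<close>, is admissible for \<open>V\<close> in
  \<open>D\<close> with the same \<open>C\<close>, since the maximum of \<open>dim (V W)\<close> and \<open>dim (W V)\<close> dominates \<open>dim (V W)\<close>.\<close>

section \<open>Finite-dimensional subspaces\<close>

context vector_space
begin

lemma dim_mono_finite:
  assumes "X \<subseteq> span B" "finite B" "Y \<subseteq> X"
  shows "dim Y \<le> dim X"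
proof -
  obtain C where C: "C \<subseteq> X" "independent C" "X \<subseteq> span C" "card C = dim X"
    using basis_exists by blast
  have "finite C"
    using independent_span_bound[OF assms(2) C(2)] C(1) assms(1) by blast
  then show ?thesis
    using dim_le_card[of Y C] C assms(3) by auto
qed

text \<open>Rank-nullity on a finite-dimensional subspace of a possibly infinite-dimensional space.\<close>

lemma dim_kernel_image:
  assumes f: "Vector_Spaces.linear scale scale f"
    and U: "subspace U" "finite B" "U \<subseteq> span B"
  shows "dim U = dim (U \<inter> {x. f x = 0}) + dim (f ` U)"
proof -
  interpret f: Vector_Spaces.linear scale scale f by (fact f)
  let ?K = "U \<inter> {x. f x = 0}"
  have sK: "subspace ?K"
    by (rule subspace_inter[OF U(1) f.subspace_kernel])
  obtain K where K: "K \<subseteq> ?K" "independent K" "?K \<subseteq> span K" "card K = dim ?K"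
    using basis_exists by blast
  obtain G where G: "K \<subseteq> G" "G \<subseteq> U" "independent G" "U \<subseteq> span G"
    using maximal_independent_subset_extend[of K U] K(1,2) by auto
  have finG: "finite G"
    using independent_span_bound[OF U(2) G(3)] G(2) U(3) by blast
  have inj: "inj_on f (span (G - K))"
  proof (subst f.inj_on_iff_eq_0[OF subspace_span], intro ballI impI)
    fix x assume x: "x \<in> span (G - K)" "f x = 0"
    have "span (G - K) \<subseteq> U"
      using G(2) U(1) by (intro span_minimal) auto
    then have xK: "x \<in> span K"
      using x K(3) by auto
    have rep: "representation G x v = representation (G - K) x v"
              "representation G x v = representation K x v" for v
      using representation_extend[OF G(3) x(1)] representation_extend[OF G(3) xK] G(1) by auto
    have "representation G x v = 0" for v
      using rep[of v] representation_ne_zero[of "G - K" x v] representation_ne_zero[of K x v]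
      by auto
    moreover have "x \<in> span G"
      using xK span_mono[OF G(1)] by auto
    ultimately show "x = 0"
      using sum_nonzero_representation_eq[OF G(3), of x] by simp
  qed
  have ind: "independent (f ` (G - K))"
    using f.independent_injective_image[OF independent_mono[OF G(3)] inj] by auto
  have "f ` U \<subseteq> span (f ` (G - K))"
  proof -
    have "f x \<in> span (f ` (G - K))" if "x \<in> G" for x
    proof (cases "x \<in> K")
      case True
      then have "f x = 0" using K(1) by auto
      then show ?thesis using span_zero by simp
    qed (use that in \<open>auto intro: span_base\<close>)
    then have "f ` G \<subseteq> span (f ` (G - K))"
      by blast
    then have "span (f ` G) \<subseteq> span (f ` (G - K))"
      by (rule span_minimal) auto
    then show ?thesis
      using f.spans_image[OF G(4)] by auto
  qed
  then have "dim (f ` U) = card (f ` (G - K))"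
    using ind G(2) by (intro dim_unique) auto
  also have "\<dots> = card (G - K)"
    by (rule card_image[OF inj_on_subset[OF inj span_superset]])
  also have "\<dots> = card G - card K"
    using finG G(1) by (simp add: card_Diff_subset finite_subset)
  finally have "dim (f ` U) = card G - card K" .
  moreover have "dim U = card G"
    using G by (intro dim_unique) auto
  moreover have "card K \<le> card G"
    using finG G(1) by (rule card_mono)
  ultimately show ?thesis
    using K(4) by simp
qed

lemma linear_with_kernel:
  assumes "subspace S"
  obtains p where "Vector_Spaces.linear scale scale p" "\<And>x. p x = 0 \<longleftrightarrow> x \<in> S"
proof -
  interpret vp: vector_space_pair scale scale ..
  obtain q where q: "range q \<subseteq> S" "Vector_Spaces.linear scale scale q" "\<forall>v\<in>S. q v = v"
    using vp.linear_exists_left_inverse_on[OF linear_ident assms] by auto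
  show thesis
  proof
    show "Vector_Spaces.linear scale scale (\<lambda>x. x - q x)"
      by (rule vp.linear_compose_sub[OF linear_ident q(2)])
    show "x - q x = 0 \<longleftrightarrow> x \<in> S" for x
      using q(1,3) by auto
  qed
qed

end

section \<open>Products of subspaces\<close>

context domain_algebra
begin

lemma linear_mult_right: "Vector_Spaces.linear scale scale (\<lambda>x. x * b)"
  by unfold_locales (simp_all add: distrib_right scale_mult_left)

lemma linear_mult_left: "Vector_Spaces.linear scale scale (\<lambda>x. b * x)"
  by unfold_locales (simp_all add: distrib_left scale_mult_right)

lemma subspace_prod_space: "subspace (prod_space V W)"
  unfolding prod_space_def by simp

lemma prod_space_mult: "v \<in> V \<Longrightarrow> w \<in> W \<Longrightarrow> v * w \<in> prod_space V W"
  unfolding prod_space_def by (auto intro: span_base)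

lemma prod_space_minimal:
  assumes "subspace U" "\<And>v w. v \<in> V \<Longrightarrow> w \<in> W \<Longrightarrow> v * w \<in> U"
  shows "prod_space V W \<subseteq> U"
  unfolding prod_space_def using assms by (intro span_minimal) auto

lemma prod_space_finite_span:
  assumes B: "finite B" "V \<subseteq> span B" and C: "finite C" "W \<subseteq> span C"
  obtains G where "finite G" "prod_space V W \<subseteq> span G"
proof
  let ?G = "(\<lambda>(b, c). b * c) ` (B \<times> C)"
  show "finite ?G" using B C by simp
  have left: "b * w \<in> span ?G" if "b \<in> B" "w \<in> span C" for b w
  proof -
    interpret m: Vector_Spaces.linear scale scale "\<lambda>x. b * x" by (rule linear_mult_left)
    have "C \<subseteq> {x. b * x \<in> span ?G}"
      using that(1) by (auto intro!: span_base)
    then have "span C \<subseteq> {x. b * x \<in> span ?G}"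
      by (rule span_minimal) (rule m.subspace_linear_preimage[OF subspace_span])
    then show ?thesis using that(2) by auto
  qed
  have "v * w \<in> span ?G" if "v \<in> span B" "w \<in> span C" for v w
  proof -
    interpret m: Vector_Spaces.linear scale scale "\<lambda>x. x * w" by (rule linear_mult_right)
    have "B \<subseteq> {x. x * w \<in> span ?G}"
      using left that(2) by auto
    then have "span B \<subseteq> {x. x * w \<in> span ?G}"
      by (rule span_minimal) (rule m.subspace_linear_preimage[OF subspace_span])
    then show ?thesis using that(1) by auto
  qed
  then show "prod_space V W \<subseteq> span ?G"
    using B C by (intro prod_space_minimal) auto
qed

text \<open>Only on \<open>W\<close> does \<open>f\<close> have to commute with left multiplication by \<open>V\<close>, which lets \<open>f\<close> be an
  arbitrary \<open>k\<close>-linear extension of an \<open>E\<close>-linear coordinate.\<close>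

lemma dim_prod_space_split:
  assumes f: "Vector_Spaces.linear scale scale f"
    and V: "finite A" "V \<subseteq> span A"
    and W: "subspace W" "finite B" "W \<subseteq> span B"
    and comm: "\<And>v w. v \<in> V \<Longrightarrow> w \<in> W \<Longrightarrow> f (v * w) = v * f w"
  shows "dim (prod_space V (W \<inter> {x. f x = 0})) + dim (prod_space V (f ` W))
    \<le> dim (prod_space V W)"
proof -
  interpret f: Vector_Spaces.linear scale scale f by (fact f)
  obtain G where G: "finite G" "prod_space V W \<subseteq> span G"
    using prod_space_finite_span[OF V W(2,3)] .
  let ?P = "prod_space V W \<inter> {x. f x = 0}"
  have "prod_space V (W \<inter> {x. f x = 0}) \<subseteq> ?P"
    using comm
    by (intro prod_space_minimal subspace_inter subspace_prod_space f.subspace_kernel)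
       (auto intro: prod_space_mult)
  then have 1: "dim (prod_space V (W \<inter> {x. f x = 0})) \<le> dim ?P"
    using G by (intro dim_mono_finite[of ?P G]) auto
  have "v * f w \<in> f ` prod_space V W" if "v \<in> V" "w \<in> W" for v w
    using comm[OF that] prod_space_mult[OF that] by (metis imageI)
  then have "prod_space V (f ` W) \<subseteq> f ` prod_space V W"
    by (intro prod_space_minimal f.subspace_image subspace_prod_space) auto
  then have 2: "dim (prod_space V (f ` W)) \<le> dim (f ` prod_space V W)"
    using G f.spans_image[OF G(2)] by (intro dim_mono_finite[of _ "f ` G"]) auto
  show ?thesis
    using dim_kernel_image[OF f subspace_prod_space G] 1 2 by linarith
qed

end

section \<open>Left coordinates over a division subalgebra\<close>

context division_algebra
begin

lemma dim_mult_right_image: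
  assumes "b \<noteq> 0" "subspace U" "finite B" "U \<subseteq> span B"
  shows "dim ((\<lambda>x. x * b) ` U) = dim U"
proof -
  have "U \<inter> {x. x * b = 0} = {0}"
    using assms(1,2) subspace_0 by auto
  moreover have "dim {0} = 0"
    using dim_le_card[of "{0}" "{}"] by simp
  ultimately show ?thesis
    using dim_kernel_image[OF linear_mult_right assms(2-4), of b] by simp
qed

text \<open>A nonzero subspace becomes a subframe after right multiplication by the inverse of one of its
  elements, and right multiplication commutes with left multiplication by \<open>V\<close>. So the
  condition that \<open>1\<close> lies in the test space costs nothing.\<close>

lemma growth_without_unit:
  assumes E: "division_subalgebra E"
    and V: "finite A" "V \<subseteq> span A"
    and growth: "\<And>W. subframe E W \<Longrightarrow> \<phi> (dim W) \<le> real (dim (prod_space V W))"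
    and \<phi>0: "\<phi> 0 \<le> (0::real)"
    and X: "subspace X" "X \<subseteq> E" "finite B" "X \<subseteq> span B"
  shows "\<phi> (dim X) \<le> real (dim (prod_space V X))"
proof (cases "X \<subseteq> {0}")
  case True
  then have "dim X = 0"
    using dim_le_card[of X "{}"] by simp
  then show ?thesis using \<phi>0 by simp
next
  case False
  then obtain x where x: "x \<in> X" "x \<noteq> 0" by auto
  let ?r = "\<lambda>y. y * inverse x"
  interpret r: Vector_Spaces.linear scale scale ?r by (rule linear_mult_right)
  obtain G where G: "finite G" "prod_space V X \<subseteq> span G"
    using prod_space_finite_span[OF V X(3,4)] .
  have "subframe E (?r ` X)"
    unfolding subframe_def
  proof (intro conjI)
    show "?r ` X \<subseteq> E"
      using E X(2) x unfolding division_subalgebra_def by auto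
    show "subspace (?r ` X)"
      by (rule r.subspace_image[OF X(1)])
    show "1 \<in> ?r ` X"
      using x by (auto intro!: image_eqI[of _ _ x])
    show "\<exists>B. finite B \<and> ?r ` X \<subseteq> span B"
      using X(3) r.spans_image[OF X(4)] by (intro exI[of _ "?r ` B"]) auto
  qed
  then have "\<phi> (dim (?r ` X)) \<le> real (dim (prod_space V (?r ` X)))"
    by (rule growth)
  also have "v * ?r y \<in> ?r ` prod_space V X" if "v \<in> V" "y \<in> X" for v y
    using prod_space_mult[OF that] by (auto simp: mult.assoc[symmetric])
  then have "prod_space V (?r ` X) \<subseteq> ?r ` prod_space V X"
    by (intro prod_space_minimal r.subspace_image subspace_prod_space) auto
  then have "dim (prod_space V (?r ` X)) \<le> dim (?r ` prod_space V X)"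
    using G r.spans_image[OF G(2)] by (intro dim_mono_finite[of _ "?r ` G"]) auto
  also have "dim (?r ` prod_space V X) = dim (prod_space V X)"
    using x G by (intro dim_mult_right_image subspace_prod_space) auto
  also have "dim (?r ` X) = dim X"
    using x X by (intro dim_mult_right_image) auto
  finally show ?thesis by simp
qed

lemma prod_space_left_closed:
  assumes "division_subalgebra E" "e \<in> E" "x \<in> prod_space E F"
  shows "e * x \<in> prod_space E F"
proof -
  interpret m: Vector_Spaces.linear scale scale "\<lambda>x. e * x" by (rule linear_mult_left)
  have "prod_space E F \<subseteq> {x. e * x \<in> prod_space E F}"
    using assms(1,2) unfolding division_subalgebra_def
    by (intro prod_space_minimal m.subspace_linear_preimage subspace_prod_space)
       (auto simp: mult.assoc[symmetric] intro!: prod_space_mult)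
  then show ?thesis using assms(3) by auto
qed

lemma prod_space_insert:
  assumes E: "division_subalgebra E" and x: "x \<in> prod_space E (insert b F)"
  obtains s e where "s \<in> prod_space E F" "e \<in> E" "x = s + e * b"
proof -
  interpret m: Vector_Spaces.linear scale scale "\<lambda>x. x * b" by (rule linear_mult_right)
  have sE: "subspace E"
    using E unfolding division_subalgebra_def by blast
  let ?U = "{s + y | s y. s \<in> prod_space E F \<and> y \<in> (\<lambda>e. e * b) ` E}"
  have "subspace ?U"
    by (intro subspace_sums subspace_prod_space m.subspace_image sE)
  moreover have "e * c \<in> ?U" if "e \<in> E" "c \<in> insert b F" for e c
  proof (cases "c = b")
    case True
    then have "e * c = 0 + e * b" by simp
    then show ?thesis
      using that(1) subspace_0[OF subspace_prod_space] by blast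
  next
    case False
    then have "e * c \<in> prod_space E F" "e * c = e * c + 0 * b"
      using that by (auto intro: prod_space_mult)
    then show ?thesis
      using subspace_0[OF sE] by blast
  qed
  ultimately have "prod_space E (insert b F) \<subseteq> ?U"
    by (rule prod_space_minimal)
  then show thesis using x that by blast
qed

text \<open>The coordinate of \<open>S \<oplus> E b\<close> along \<open>b\<close>, for a left \<open>E\<close>-submodule \<open>S\<close> that does not contain
  \<open>b\<close>. It is obtained by passing to the quotient by \<open>S\<close>, where \<open>e \<mapsto> e b\<close> is still injective on
  \<open>E\<close>, and taking a left inverse there. It is extended \<open>k\<close>-linearly to all of \<open>D\<close>, which keeps
  it inside the total linear maps of the ambient space.\<close>

lemma coordinate_exists:
  assumes E: "division_subalgebra E"
    and S: "subspace S" "\<And>e s. e \<in> E \<Longrightarrow> s \<in> S \<Longrightarrow> e * s \<in> S"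
    and b: "b \<notin> S"
  obtains f where "Vector_Spaces.linear scale scale f"
    "\<And>s e. s \<in> S \<Longrightarrow> e \<in> E \<Longrightarrow> f (s + e * b) = e"
proof -
  interpret vp: vector_space_pair scale scale ..
  have sE: "subspace E"
    using E unfolding division_subalgebra_def by blast
  obtain p where p: "Vector_Spaces.linear scale scale p" "\<And>x. p x = 0 \<longleftrightarrow> x \<in> S"
    using linear_with_kernel[OF S(1)] by blast
  interpret p: Vector_Spaces.linear scale scale p by (fact p(1))
  let ?q = "p \<circ> (\<lambda>e. e * b)"
  have q: "Vector_Spaces.linear scale scale ?q"
    by (rule Vector_Spaces.linear_compose[OF linear_mult_right p(1)])
  have "inj_on ?q E"
  proof (subst vp.linear_inj_on_iff_eq_0[OF q sE], intro ballI impI)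
    fix e assume e: "e \<in> E" "?q e = 0"
    show "e = 0"
    proof (rule ccontr)
      assume "e \<noteq> 0"
      then have "inverse e \<in> E"
        using E e(1) unfolding division_subalgebra_def by blast
      moreover have "e * b \<in> S"
        using e(2) p(2) by simp
      ultimately have "inverse e * (e * b) \<in> S"
        by (rule S(2))
      then show False
        using b \<open>e \<noteq> 0\<close> by (simp add: mult.assoc[symmetric])
    qed
  qed
  then obtain g where g: "Vector_Spaces.linear scale scale g" "\<forall>e\<in>E. g (?q e) = e"
    using vp.linear_exists_left_inverse_on[OF q sE] by blast
  interpret g: Vector_Spaces.linear scale scale g by (fact g(1))
  show thesis
  proof
    show "Vector_Spaces.linear scale scale (g \<circ> p)"
      by (rule Vector_Spaces.linear_compose[OF p(1) g(1)])
    show "(g \<circ> p) (s + e * b) = e" if "s \<in> S" "e \<in> E" for s e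
      using that g(2) p(2)[of s] by (simp add: p.add)
  qed
qed

section \<open>Extending growth bounds from a division subalgebra\<close>

lemma growth_extends:
  assumes E: "division_subalgebra E"
    and V: "finite A" "V \<subseteq> span A" "V \<subseteq> E"
    and growth: "\<And>W. subframe E W \<Longrightarrow> \<phi> (dim W) \<le> real (dim (prod_space V W))"
    and \<phi>0: "\<phi> 0 \<le> (0::real)"
    and \<phi>_add: "\<And>m n. \<phi> (m + n) \<le> \<phi> m + \<phi> n"
    and W: "subspace W" "finite B" "W \<subseteq> span B"
  shows "\<phi> (dim W) \<le> real (dim (prod_space V W))"
proof -
  have "\<phi> (dim W) \<le> real (dim (prod_space V W))"
    if "finite F" "subspace W" "W \<subseteq> span B" "W \<subseteq> prod_space E F" for F W
    using that
  proof (induction F arbitrary: W rule: finite_induct)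
    case empty
    have "prod_space E {} = {0}"
      unfolding prod_space_def by simp
    then have "dim W = 0"
      using empty dim_le_card[of W "{}"] by simp
    then show ?case using \<phi>0 by simp
  next
    case (insert b F)
    let ?S = "prod_space E F"
    show ?case
    proof (cases "b \<in> ?S")
      case True
      have "x \<in> ?S" if "x \<in> prod_space E (insert b F)" for x
        using that
        by (rule prod_space_insert[OF E])
           (auto intro: subspace_add[OF subspace_prod_space] prod_space_left_closed[OF E _ True])
      then show ?thesis
        using insert by blast
    next
      case False
      obtain f where f: "Vector_Spaces.linear scale scale f"
        "\<And>s e. s \<in> ?S \<Longrightarrow> e \<in> E \<Longrightarrow> f (s + e * b) = e"
        using coordinate_exists[OF E subspace_prod_space prod_space_left_closed[OF E] False] by blast
      interpret f: Vector_Spaces.linear scale scale f by (fact f(1))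
      let ?K = "W \<inter> {x. f x = 0}"
      have coord: "f x \<in> E \<and> (\<exists>s\<in>?S. x = s + f x * b)" if "x \<in> W" for x
      proof -
        have "x \<in> prod_space E (insert b F)"
          using insert.prems(3) that by blast
        then obtain s e where "s \<in> ?S" "e \<in> E" "x = s + e * b"
          by (rule prod_space_insert[OF E])
        then show ?thesis using f(2) by auto
      qed
      have comm: "f (v * x) = v * f x" if v: "v \<in> V" and x: "x \<in> W" for v x
      proof -
        obtain s where s: "s \<in> ?S" "x = s + f x * b" and fx: "f x \<in> E"
          using coord[OF x] by auto
        have "v * x = v * s + (v * f x) * b"
          by (subst s(2)) (simp add: distrib_left mult.assoc)
        moreover have "v * s \<in> ?S" "v * f x \<in> E"
          using v V(3) s(1) fx E prod_space_left_closed[OF E]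
          unfolding division_subalgebra_def by auto
        ultimately show ?thesis using f(2) by simp
      qed
      have "?K \<subseteq> ?S"
        using coord by force
      moreover have "subspace ?K"
        by (rule subspace_inter[OF insert.prems(1) f.subspace_kernel])
      ultimately have kernel: "\<phi> (dim ?K) \<le> real (dim (prod_space V ?K))"
        using insert.prems(2) by (intro insert.IH) auto
      have image: "\<phi> (dim (f ` W)) \<le> real (dim (prod_space V (f ` W)))"
        using coord W(2) f.spans_image[OF insert.prems(2)]
        by (intro growth_without_unit[OF E V(1,2) growth \<phi>0, of _ "f ` B"]
              f.subspace_image insert.prems(1)) auto
      have "dim W = dim ?K + dim (f ` W)"
        by (rule dim_kernel_image[OF f(1) insert.prems(1) W(2) insert.prems(2)])
      moreover have "dim (prod_space V ?K) + dim (prod_space V (f ` W)) \<le> dim (prod_space V W)"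
        by (rule dim_prod_space_split[OF f(1) V(1,2) insert.prems(1) W(2) insert.prems(2) comm])
      ultimately show ?thesis
        using \<phi>_add[of "dim ?K" "dim (f ` W)"] kernel image by simp
    qed
  qed
  moreover have "B \<subseteq> prod_space E B"
    using E prod_space_mult[of 1 E _ B] unfolding division_subalgebra_def by auto
  then have "span B \<subseteq> prod_space E B"
    by (rule span_minimal[OF _ subspace_prod_space])
  ultimately show ?thesis
    using W by blast
qed

end

text \<open>Write \<open>x powr a = x * x powr (a - 1)\<close>; the second factor decreases in \<open>x\<close> because
  \<open>a \<le> 1\<close>. Negative exponents, which occur for \<open>d < 1\<close>, are covered too.\<close>

lemma powr_subadditive:
  fixes a x y :: real
  assumes "a \<le> 1" "0 \<le> x" "0 \<le> y"
  shows "(x + y) powr a \<le> x powr a + y powr a"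
proof (cases "x = 0 \<or> y = 0")
  case False
  then have pos: "0 < x" "0 < y" using assms by auto
  have split: "z powr a = z * z powr (a - 1)" if "0 < z" for z :: real
    using that by (simp add: powr_diff)
  have "(x + y) powr a = x * (x + y) powr (a - 1) + y * (x + y) powr (a - 1)"
    using pos by (simp add: split distrib_right)
  also have "\<dots> \<le> x * x powr (a - 1) + y * y powr (a - 1)"
    using pos assms(1) by (intro add_mono mult_left_mono powr_mono2') auto
  finally show ?thesis using pos by (simp add: split)
qed auto

context division_algebra
begin

lemma VDI_le_VDI_star:
  assumes E: "division_subalgebra E" and V: "subframe E V"
  shows "VDI E V \<le> VDI_star UNIV V"
  unfolding VDI_def VDI_star_def
proof (rule Sup_subset_mono, safe)
  fix d C :: real
  assume d: "d > 0" and C: "C > 0"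
    and growth: "\<forall>W. subframe E W \<longrightarrow>
      real (dim (prod_space V W)) \<ge> real (dim W) + C * real (dim W) powr ((d - 1) / d)"
  let ?\<phi> = "\<lambda>n::nat. real n + C * real n powr ((d - 1) / d)"
  obtain A where A: "finite A" "V \<subseteq> span A" "V \<subseteq> E"
    using V unfolding subframe_def by blast
  have "(d - 1) / d \<le> 1"
    using d by simp
  then have sub: "?\<phi> (m + n) \<le> ?\<phi> m + ?\<phi> n" for m n
    using mult_left_mono[OF powr_subadditive[of "(d - 1) / d" "real m" "real n"], of C] C
    by (simp add: distrib_left)
  have "real (max (dim (prod_space V W)) (dim (prod_space W V))) \<ge> ?\<phi> (dim W)"
    if W: "subframe UNIV W" for W
  proof -
    obtain B where B: "finite B" "W \<subseteq> span B" "subspace W"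
      using W unfolding subframe_def by blast
    have "?\<phi> (dim W) \<le> real (dim (prod_space V W))"
      using growth_extends[OF E A, of ?\<phi> W B] growth sub B by simp
    then show ?thesis by simp
  qed
  then show "\<exists>d'. ennreal d = ennreal d' \<and> d' > 0 \<and> (\<exists>C>0. \<forall>W. subframe UNIV W \<longrightarrow>
      real (dim W) + C * real (dim W) powr ((d' - 1) / d')
        \<le> real (max (dim (prod_space V W)) (dim (prod_space W V))))"
    using d C by blast
qed

lemma Ld_le_Ld_star:
  assumes "division_subalgebra E"
  shows "Ld E \<le> Ld_star UNIV"
  unfolding Ld_def Ld_star_def
proof (rule Sup_mono, safe)
  fix V assume V: "subframe E V"
  then have "subframe UNIV V"
    unfolding subframe_def by auto
  then show "\<exists>b\<in>{VDI_star UNIV V | V. subframe UNIV V}. VDI E V \<le> b"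
    using VDI_le_VDI_star[OF assms V] by blast
qed

end

theorem mainTheorem4:
  fixes scale :: "'k::field \<Rightarrow> 'd::division_ring \<Rightarrow> 'd" and E :: "'d set"
  assumes "division_algebra scale"
    and "division_algebra.division_subalgebra scale E"
  shows "domain_algebra.Ld scale E \<le> domain_algebra.Ld_star scale UNIV"
  using division_algebra.Ld_le_Ld_star[OF assms] .

end
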